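(* For all integers $n\ge 0$, $$\#A(n)=\#B(n)=\#C(n).$$
   Context: Write $\lambda\vdash n$ if $\lambda=(\lambda_1,\lambda_2,\dots,\lambda_l)$ is a partition of $n$, i.e. a weakly decreasing sequence of positive integers (parts) with sum $n$ (the empty partition is the unique partition of $0$). A partition is self conjugate if it equals its conjugate, i.e. its Young diagram is symmetric about the main diagonal. Cells of a Young diagram are indexed as in a matrix: $(i,j)$ is the cell in row $i$ from the top and column $j$ from the left. $A(n)$ is the set of $\lambda\vdash n$ satisfying: (a) the even parts of $\lambda$ are distinct, and (b) if $2m<\lambda_1$ for some positive integer $m$, then $2m$ is a part of $\lambda$. For a partition $\lambda$, the odd Ferrers graph $T^\lambda$ is the filling of the cells $(i,j)$ of the Young diagram of $\lambda$ given by $T^\lambda_{i,j}=1$ if $i=1$ or $j=1$, and $T^\lambda_{i,j}=2$ otherwise. Let $|T^\lambda|=\sum_{(i,j)\in\lambda}T^\lambda_{i,j}$. Define $B(n)=\{T^\lambda : \lambda \text{ is self conjugate and } |T^\lambda|=2n+1\}$. $C(n)=\{\lambda\vdash 4n+1 : \lambda \text{ is self conjugate and all parts of } \lambda \text{ are odd}\}$. *)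

theory Defs
  imports Main
begin

definition partitions :: "nat \<Rightarrow> nat list set" where
  "partitions n = {\<mu>. sorted_wrt (\<ge>) \<mu> \<and> (\<forall>k \<in> set \<mu>. 0 < k) \<and> sum_list \<mu> = n}"

text \<open>Rows and columns are numbered from 1, whereas list positions start at 0.\<close>

definition young_diagram :: "nat list \<Rightarrow> (nat \<times> nat) set" where
  "young_diagram \<mu> = {(i, j). 1 \<le> i \<and> i \<le> length \<mu> \<and> 1 \<le> j \<and> j \<le> \<mu> ! (i - 1)}"

text \<open>The entries are the column lengths of the Young diagram; for a partition the columns are
  numbered from 1 to its largest part.\<close>

definition conjugate :: "nat list \<Rightarrow> nat list" where
  "conjugate \<mu> =
     map (\<lambda>j. card {i. (i, j) \<in> young_diagram \<mu>}) [1..<Suc (if \<mu> = [] then 0 else hd \<mu>)]"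

definition self_conjugate :: "nat list \<Rightarrow> bool" where
  "self_conjugate \<mu> \<longleftrightarrow> conjugate \<mu> = \<mu>"

definition A :: "nat \<Rightarrow> nat list set" where
  "A n = {\<mu> \<in> partitions n. distinct (filter even \<mu>) \<and>
            (\<forall>m>0. \<mu> \<noteq> [] \<and> 2 * m < hd \<mu> \<longrightarrow> 2 * m \<in> set \<mu>)}"

text \<open>A filling is a partial map whose domain is the set of filled cells.\<close>

definition odd_ferrers_graph :: "nat list \<Rightarrow> (nat \<times> nat \<Rightarrow> nat option)" where
  "odd_ferrers_graph \<mu> = (\<lambda>(i, j).
     if (i, j) \<in> young_diagram \<mu> then Some (if i = 1 \<or> j = 1 then 1 else 2) else None)"

definition filling_sum :: "(nat \<times> nat \<Rightarrow> nat option) \<Rightarrow> nat" where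
  "filling_sum T = (\<Sum>c \<in> dom T. the (T c))"

definition B :: "nat \<Rightarrow> (nat \<times> nat \<Rightarrow> nat option) set" where
  "B n = {odd_ferrers_graph \<mu> | \<mu>. (\<exists>k. \<mu> \<in> partitions k) \<and> self_conjugate \<mu> \<and>
            filling_sum (odd_ferrers_graph \<mu>) = 2 * n + 1}"

definition C :: "nat \<Rightarrow> nat list set" where
  "C n = {\<mu> \<in> partitions (4 * n + 1). self_conjugate \<mu> \<and> (\<forall>k \<in> set \<mu>. odd k)}"

lemma dom_odd_ferrers_graph [simp]: "dom (odd_ferrers_graph \<mu>) = young_diagram \<mu>"
  by (auto simp: odd_ferrers_graph_def split: if_splits)

lemma young_diagram_row:
  "young_diagram \<mu> = (SIGMA i:{1..length \<mu>}. {1..\<mu> ! (i - 1)})"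
  by (auto simp: young_diagram_def)

lemma finite_young_diagram [simp]: "finite (young_diagram \<mu>)"
  by (simp add: young_diagram_row)

lemma card_young_diagram: "card (young_diagram \<mu>) = sum_list \<mu>"
proof -
  have "card (young_diagram \<mu>) = (\<Sum>i\<in>{1..length \<mu>}. \<mu> ! (i - 1))"
    by (simp add: young_diagram_row)
  also have "\<dots> = (\<Sum>i<length \<mu>. \<mu> ! i)"
    by (rule sum.reindex_bij_witness[of _ Suc "\<lambda>i. i - 1"]) auto
  finally show ?thesis by (simp add: sum_list_sum_nth lessThan_atLeast0)
qed

lemma finite_partitions: "finite (partitions n)"
proof -
  have len: "length xs \<le> sum_list xs" if "\<forall>k\<in>set xs. 0 < k" for xs :: "nat list"
    using that by (induction xs) auto
  have "partitions n \<subseteq> {xs. set xs \<subseteq> {..n} \<and> length xs \<le> n}"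
    using len by (auto simp: partitions_def intro: member_le_sum_list)
  then show ?thesis
    by (rule finite_subset) (rule finite_lists_length_le, simp)
qed

lemma finite_A: "finite (A n)" and finite_C: "finite (C n)"
  unfolding A_def C_def using finite_partitions by auto

lemma finite_B: "finite (B n)"
proof -
  have "sum_list \<mu> \<le> filling_sum (odd_ferrers_graph \<mu>)" for \<mu>
  proof -
    have "card (young_diagram \<mu>) \<le> filling_sum (odd_ferrers_graph \<mu>)"
      unfolding filling_sum_def dom_odd_ferrers_graph card_eq_sum
      by (rule sum_mono) (auto simp: odd_ferrers_graph_def)
    then show ?thesis by (simp add: card_young_diagram)
  qed
  note le = this
  have "B n \<subseteq> odd_ferrers_graph ` (\<Union>k\<le>2 * n + 1. partitions k)"
  proof
    fix T assume "T \<in> B n"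
    then obtain \<mu> k where \<mu>: "T = odd_ferrers_graph \<mu>" "\<mu> \<in> partitions k"
        "filling_sum (odd_ferrers_graph \<mu>) = 2 * n + 1"
      unfolding B_def by blast
    then have "k \<le> 2 * n + 1"
      using le[of \<mu>] by (simp add: partitions_def)
    with \<mu> show "T \<in> odd_ferrers_graph ` (\<Union>k\<le>2 * n + 1. partitions k)" by blast
  qed
  then show ?thesis
    by (rule finite_subset) (simp add: finite_partitions)
qed

lemma young_diagram_conjugate:
  assumes "\<mu> \<in> partitions n"
  shows "young_diagram (conjugate \<mu>) = (young_diagram \<mu>)\<inverse>"
proof -
  have dec: "\<mu> ! b \<le> \<mu> ! a" if "a \<le> b" "b < length \<mu>" for a b
    using assms that by (cases "a = b") (auto simp: partitions_def sorted_wrt_iff_nth_less)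
  define N where "N = (if \<mu> = [] then 0 else hd \<mu>)"
  have hdmax: "\<mu> ! a \<le> N" if "a < length \<mu>" for a
    using dec[of 0 a] that by (auto simp: N_def hd_conv_nth)
  have len: "length (conjugate \<mu>) = N"
    by (simp add: conjugate_def N_def)
  have nth: "conjugate \<mu> ! (j - 1) = card {i. (i, j) \<in> young_diagram \<mu>}" if "1 \<le> j" "j \<le> N" for j
  proof -
    have "j - 1 < length [1..<Suc N]" using that by simp
    then show ?thesis using that unfolding conjugate_def N_def[symmetric]
      by (simp only: nth_map) (simp add: nth_upt del: upt_Suc)
  qed
  have col: "i \<le> card {i. (i, j) \<in> young_diagram \<mu>} \<longleftrightarrow> (i, j) \<in> young_diagram \<mu>"
    if "1 \<le> i" "1 \<le> j" for i j
  proof -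
    let ?S = "{i. (i, j) \<in> young_diagram \<mu>}"
    have fin: "finite ?S"
      by (rule finite_subset[of _ "{..length \<mu>}"]) (auto simp: young_diagram_def)
    have down: "a \<in> ?S" if "b \<in> ?S" "1 \<le> a" "a \<le> b" for a b
    proof -
      have "\<mu> ! (b - 1) \<le> \<mu> ! (a - 1)"
        using that by (intro dec) (auto simp: young_diagram_def)
      then show ?thesis using that by (auto simp: young_diagram_def)
    qed
    show ?thesis
    proof
      assume "(i, j) \<in> young_diagram \<mu>"
      then have "{1..i} \<subseteq> ?S" using down by auto
      from card_mono[OF fin this] show "i \<le> card ?S" by simp
    next
      assume le: "i \<le> card ?S"
      show "(i, j) \<in> young_diagram \<mu>"
      proof (rule ccontr)
        assume "(i, j) \<notin> young_diagram \<mu>"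
        then have "?S \<subseteq> {1..<i}"
        proof (intro subsetI)
          fix b assume b: "b \<in> ?S"
          then have "1 \<le> b" by (auto simp: young_diagram_def)
          moreover have "b < i"
            using down[OF b \<open>1 \<le> i\<close>] \<open>(i, j) \<notin> young_diagram \<mu>\<close> by (cases "b < i") auto
          ultimately show "b \<in> {1..<i}" by simp
        qed
        from card_mono[OF _ this] show False using le \<open>1 \<le> i\<close> by simp
      qed
    qed
  qed
  show ?thesis
  proof (intro set_eqI, clarify)
    fix j i
    have "(j, i) \<in> young_diagram (conjugate \<mu>) \<longleftrightarrow>
        1 \<le> j \<and> j \<le> N \<and> 1 \<le> i \<and> i \<le> conjugate \<mu> ! (j - 1)"
      by (simp add: young_diagram_def len)
    also have "\<dots> \<longleftrightarrow> 1 \<le> j \<and> j \<le> N \<and> 1 \<le> i \<and> (i, j) \<in> young_diagram \<mu>"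
      using nth col by auto
    also have "\<dots> \<longleftrightarrow> (i, j) \<in> young_diagram \<mu>"
    proof
      assume c: "(i, j) \<in> young_diagram \<mu>"
      then have "j \<le> \<mu> ! (i - 1)" "i - 1 < length \<mu>" by (auto simp: young_diagram_def)
      with hdmax[of "i - 1"] have "j \<le> N" by simp
      with c show "1 \<le> j \<and> j \<le> N \<and> 1 \<le> i \<and> (i, j) \<in> young_diagram \<mu>"
        by (auto simp: young_diagram_def)
    qed simp
    finally show "(j, i) \<in> young_diagram (conjugate \<mu>) \<longleftrightarrow> (j, i) \<in> (young_diagram \<mu>)\<inverse>" by simp
  qed
qed

end

theory Submission
  imports Defs "HOL-Library.Multiset"
begin

text \<open>All three sets are compared through Young diagrams. A partition is the same thing as a finite
  down-set of cells, and self conjugacy is symmetry of that down-set, so \<open>B n\<close> counts the symmetric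
  down-sets \<open>D\<close> of total weight \<open>2 * n + 1\<close>, where cells of the first row or first column weigh 1 and
  all others weigh 2.

  From \<open>B\<close> to \<open>C\<close>: double the width of every column of \<open>D\<close> except the first and the height of
  every row except the first. The corner cell stays a single cell, any other cell of weight \<open>w\<close>
  becomes \<open>2 * w\<close> cells, and so a diagram of weight \<open>2 * n + 1\<close> becomes one with \<open>4 * n + 1\<close> cells.
  All rows of the stretched diagram have odd length. Conversely, in a symmetric diagram with
  odd rows the columns have odd length as well, so the cells beyond the first row and column come in
  \<open>2 \<times> 2\<close> blocks and the stretching can be undone (\<open>stretch_surj\<close>, \<open>card_stretch\<close>).

  From \<open>B\<close> to \<open>A\<close>: let \<open>d\<close> be the side of the Durfee square of \<open>D\<close>, the largest square contained
  in \<open>D\<close>. By symmetry \<open>D\<close> is determined by \<open>d\<close> and by the partition \<open>c\<close> formed by the rows below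
  the square, which is an arbitrary partition with parts at most \<open>d\<close>. The square weighs
  \<open>2 * d * (d - 1) + 1 = 2 * (2 + 4 + \<dots> + 2 * (d - 1)) + 1\<close>, and a row of length \<open>x\<close> below it
  weighs \<open>2 * x - 1\<close>, as does its mirror image. Hence \<open>D\<close> has weight \<open>2 * n + 1\<close> exactly when the
  numbers \<open>2, 4, \<dots>, 2 * (d - 1)\<close> together with the odd numbers \<open>2 * x - 1 \<le> 2 * d - 1\<close> add up to \<open>n\<close>.
  These are precisely the partitions in \<open>A n\<close>: there the even parts form an
  initial segment of the even numbers, each occurring once, and an odd part exceeds the largest even
  part by at most 1 (and equals 1 if there is no even part). The bijections are \<open>card_durfee_pairs\<close> and \<open>card_A_eq\<close>.\<close>

section \<open>Partitions as finite down-sets\<close>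

definition diagram :: "(nat \<times> nat) set \<Rightarrow> bool" where
  "diagram D \<longleftrightarrow> finite D \<and> (\<forall>i j. (i, j) \<in> D \<longrightarrow> 0 < i \<and> 0 < j) \<and>
     (\<forall>i j i' j'. (i, j) \<in> D \<longrightarrow> 0 < i' \<longrightarrow> i' \<le> i \<longrightarrow> 0 < j' \<longrightarrow> j' \<le> j \<longrightarrow> (i', j') \<in> D)"

lemma diagramD:
  assumes "diagram D"
  shows diagram_finite: "finite D"
    and diagram_pos: "(i, j) \<in> D \<Longrightarrow> 0 < i \<and> 0 < j"
    and diagram_down: "(i, j) \<in> D \<Longrightarrow> 0 < i' \<Longrightarrow> i' \<le> i \<Longrightarrow> 0 < j' \<Longrightarrow> j' \<le> j \<Longrightarrow> (i', j') \<in> D"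
  using assms unfolding diagram_def by blast+

lemma diagram_nonempty: "diagram D \<Longrightarrow> D \<noteq> {} \<Longrightarrow> (1, 1) \<in> D"
  by (metis One_nat_def Suc_leI diagram_down diagram_pos ex_in_conv surj_pair zero_less_Suc)

lemma down_set_eq_atLeastAtMost:
  fixes S :: "nat set"
  assumes "finite S" and "0 \<notin> S" and down: "\<And>x y. x \<in> S \<Longrightarrow> 0 < y \<Longrightarrow> y \<le> x \<Longrightarrow> y \<in> S"
  shows "S = {1..card S}"
proof (cases "S = {}")
  case False
  have "S = {1..Max S}"
  proof
    show "S \<subseteq> {1..Max S}"
      using assms(1,2) by (auto simp: Suc_le_eq intro: gr0I)
    show "{1..Max S} \<subseteq> S"
      using down[OF Max_in[OF assms(1) False]] by auto
  qed
  moreover from this have "card S = Max S" by (metis card_atLeastAtMost diff_Suc_1)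
  ultimately show ?thesis by simp
qed simp

lemma diagram_young_diagram:
  assumes "\<mu> \<in> partitions n"
  shows "diagram (young_diagram \<mu>)"
proof -
  have "\<mu> ! b \<le> \<mu> ! a" if "a \<le> b" "b < length \<mu>" for a b
    using assms that by (cases "a = b") (auto simp: partitions_def sorted_wrt_iff_nth_less)
  then have dec: "\<mu> ! (i - 1) \<le> \<mu> ! (i' - 1)" if "0 < i'" "i' \<le> i" "i \<le> length \<mu>" for i i'
    using that by simp
  have "(i', j') \<in> young_diagram \<mu>"
    if "(i, j) \<in> young_diagram \<mu>" "0 < i'" "i' \<le> i" "0 < j'" "j' \<le> j" for i j i' j'
    using that dec[of i' i] by (simp add: young_diagram_def)
  moreover have "0 < i \<and> 0 < j" if "(i, j) \<in> young_diagram \<mu>" for i j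
    using that by (simp add: young_diagram_def)
  ultimately show ?thesis
    unfolding diagram_def using finite_young_diagram by blast
qed

lemma young_diagram_row_card:
  "p < length \<mu> \<Longrightarrow> card {j. (Suc p, j) \<in> young_diagram \<mu>} = \<mu> ! p"
proof -
  assume "p < length \<mu>"
  then have "{j. (Suc p, j) \<in> young_diagram \<mu>} = {1..\<mu> ! p}"
    by (auto simp: young_diagram_def)
  then show ?thesis by simp
qed

lemma young_diagram_column_card:
  assumes "\<forall>k\<in>set \<mu>. 0 < k"
  shows "card {i. (i, 1) \<in> young_diagram \<mu>} = length \<mu>"
proof -
  have "{i. (i, 1) \<in> young_diagram \<mu>} = {1..length \<mu>}"
    using assms by (auto simp: young_diagram_def Suc_le_eq)
  then show ?thesis by simp
qed

text \<open>The entries are the row lengths, and positivity makes the number of entries the length of the first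
  column. Arbitrary lists of positive numbers are allowed so that the lemma applies to a
  conjugate before it is known to be a partition.\<close>

lemma young_diagram_inject:
  assumes "\<forall>k\<in>set \<mu>. 0 < k" "\<forall>k\<in>set \<nu>. 0 < k" "young_diagram \<mu> = young_diagram \<nu>"
  shows "\<mu> = \<nu>"
  by (metis assms nth_equalityI young_diagram_column_card young_diagram_row_card)

lemma young_diagram_surj:
  assumes D: "diagram D"
  obtains \<mu> where "\<mu> \<in> partitions (card D)" "young_diagram \<mu> = D"
proof -
  define row where "row i = {j. (i, j) \<in> D}" for i
  define col where "col = {i. (i, 1) \<in> D}"
  \<comment> \<open>Rows and the first column are initial segments, so their cardinalities are lengths.\<close>
  define \<mu> where "\<mu> = map (\<lambda>i. card (row i)) [1..<Suc (card col)]"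
  have fin_row: "finite (row i)" for i
    unfolding row_def by (rule finite_subset[of _ "snd ` D"]) (use diagram_finite[OF D] in force)+
  have fin_col: "finite col"
    unfolding col_def by (rule finite_subset[of _ "fst ` D"]) (use diagram_finite[OF D] in force)+
  have row: "row i = {1..card (row i)}" for i
  proof (rule down_set_eq_atLeastAtMost[OF fin_row])
    show "0 \<notin> row i" using diagram_pos[OF D, of i 0] by (auto simp: row_def)
    show "y \<in> row i" if "x \<in> row i" "0 < y" "y \<le> x" for x y
      using that diagram_pos[OF D, of i x] diagram_down[OF D, of i x i y] by (simp add: row_def)
  qed
  have col: "col = {1..card col}"
  proof (rule down_set_eq_atLeastAtMost[OF fin_col])
    show "0 \<notin> col" using diagram_pos[OF D, of 0 1] by (auto simp: col_def)
    show "y \<in> col" if "x \<in> col" "0 < y" "y \<le> x" for x y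
      using that diagram_down[OF D, of x 1 y 1] by (simp add: col_def)
  qed
  have len: "length \<mu> = card col" by (simp add: \<mu>_def)
  have nth: "\<mu> ! p = card (row (Suc p))" if "p < length \<mu>" for p
    using that unfolding \<mu>_def by (simp del: upt_Suc)
  have mem_col: "(i, 1) \<in> D \<longleftrightarrow> 1 \<le> i \<and> i \<le> length \<mu>" for i
  proof -
    have "(i, 1) \<in> D \<longleftrightarrow> i \<in> col" by (simp add: col_def)
    also have "\<dots> \<longleftrightarrow> i \<in> {1..length \<mu>}" unfolding len using col by blast
    finally show ?thesis by simp
  qed
  have mem_row: "(i, j) \<in> D \<longleftrightarrow> 1 \<le> j \<and> j \<le> card (row i)" for i j
  proof -
    have "(i, j) \<in> D \<longleftrightarrow> j \<in> row i" by (simp add: row_def)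
    also have "\<dots> \<longleftrightarrow> j \<in> {1..card (row i)}" using row[of i] by blast
    finally show ?thesis by simp
  qed
  have young: "young_diagram \<mu> = D"
  proof (intro set_eqI, clarify)
    fix i j
    have "(i, j) \<in> D \<Longrightarrow> 1 \<le> i \<and> i \<le> length \<mu>"
      using mem_col[of i] diagram_pos[OF D, of i j] diagram_down[OF D, of i j i 1] by auto
    moreover have "1 \<le> i \<Longrightarrow> i \<le> length \<mu> \<Longrightarrow> \<mu> ! (i - 1) = card (row i)"
      using nth[of "i - 1"] by simp
    ultimately show "(i, j) \<in> young_diagram \<mu> \<longleftrightarrow> (i, j) \<in> D"
      unfolding young_diagram_def using mem_row[of i j] by auto
  qed
  have "\<mu> ! p \<le> \<mu> ! q" if "q < p" "p < length \<mu>" for p q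
  proof -
    have "row (Suc p) \<subseteq> row (Suc q)"
    proof
      fix j assume "j \<in> row (Suc p)"
      then show "j \<in> row (Suc q)"
        using that diagram_pos[OF D, of "Suc p" j] diagram_down[OF D, of "Suc p" j "Suc q" j]
        by (simp add: row_def)
    qed
    then show ?thesis using that nth fin_row by (simp add: card_mono)
  qed
  moreover have "0 < \<mu> ! p" if "p < length \<mu>" for p
    using nth[OF that] mem_col[of "Suc p"] mem_row[of "Suc p" 1] that by simp
  ultimately have "\<mu> \<in> partitions (card D)"
    using card_young_diagram[of \<mu>] young
    by (auto simp: partitions_def sorted_wrt_iff_nth_less in_set_conv_nth)
  with young show thesis using that by blast
qed

text \<open>Conjugation transposes the diagram, and a list of positive entries is determined by its diagram.\<close>

lemma self_conjugate_iff:
  assumes "\<mu> \<in> partitions n"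
  shows "self_conjugate \<mu> \<longleftrightarrow> (young_diagram \<mu>)\<inverse> = young_diagram \<mu>"
proof -
  have pos: "\<forall>k\<in>set \<mu>. 0 < k" using assms by (simp add: partitions_def)
  have "0 < card {i. (i, j) \<in> young_diagram \<mu>}" if "\<mu> \<noteq> []" "1 \<le> j" "j \<le> hd \<mu>" for j
  proof -
    have "finite {i. (i, j) \<in> young_diagram \<mu>}"
      by (rule finite_subset[of _ "{..length \<mu>}"]) (auto simp: young_diagram_def)
    moreover have "(1, j) \<in> young_diagram \<mu>"
      using that by (auto simp: young_diagram_def hd_conv_nth Suc_le_eq)
    ultimately show ?thesis by (auto simp: card_gt_0_iff)
  qed
  then have "\<forall>k\<in>set (conjugate \<mu>). 0 < k"
    by (auto simp: conjugate_def)
  with pos show ?thesis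
    unfolding self_conjugate_def using young_diagram_inject young_diagram_conjugate[OF assms]
    by metis
qed

section \<open>Symmetric diagrams counted by B and C\<close>

definition cell_weight :: "nat \<times> nat \<Rightarrow> nat" where
  "cell_weight c = (if fst c = 1 \<or> snd c = 1 then 1 else 2)"

definition ferrers_diagrams :: "nat \<Rightarrow> (nat \<times> nat) set set" where
  "ferrers_diagrams n = {D. diagram D \<and> D\<inverse> = D \<and> sum cell_weight D = 2 * n + 1}"

text \<open>A row is odd when it never ends at an even column; this form of the condition on the parts
  is a closure property of the set of cells.\<close>

definition odd_row_diagrams :: "nat \<Rightarrow> (nat \<times> nat) set set" where
  "odd_row_diagrams n = {D. diagram D \<and> D\<inverse> = D \<and> card D = 4 * n + 1 \<and>
     (\<forall>i j. (i, 2 * j) \<in> D \<longrightarrow> (i, Suc (2 * j)) \<in> D)}"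

lemma filling_sum_odd_ferrers_graph:
  "filling_sum (odd_ferrers_graph \<mu>) = sum cell_weight (young_diagram \<mu>)"
  unfolding filling_sum_def dom_odd_ferrers_graph
  by (rule sum.cong) (auto simp: odd_ferrers_graph_def cell_weight_def)

lemma inj_on_young_diagram: "inj_on young_diagram (\<Union>k. partitions k)"
  by (rule inj_onI) (auto intro!: young_diagram_inject simp: partitions_def)

text \<open>The filling determines its domain, which is the diagram, so fillings and diagrams can be
  counted interchangeably.\<close>

lemma card_B_eq: "card (B n) = card (ferrers_diagrams n)"
proof -
  define L where "L = {\<mu>. (\<exists>k. \<mu> \<in> partitions k) \<and> self_conjugate \<mu> \<and>
    filling_sum (odd_ferrers_graph \<mu>) = 2 * n + 1}"
  have inj: "inj_on young_diagram L"
    by (rule inj_on_subset[OF inj_on_young_diagram]) (auto simp: L_def)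
  have "inj_on odd_ferrers_graph L"
    by (rule inj_onI) (metis dom_odd_ferrers_graph inj inj_onD)
  moreover have "B n = odd_ferrers_graph ` L" by (auto simp: B_def L_def)
  moreover have "ferrers_diagrams n = young_diagram ` L"
  proof
    show "ferrers_diagrams n \<subseteq> young_diagram ` L"
    proof
      fix D assume D: "D \<in> ferrers_diagrams n"
      then obtain \<mu> where "\<mu> \<in> partitions (card D)" "young_diagram \<mu> = D"
        using young_diagram_surj unfolding ferrers_diagrams_def by blast
      with D show "D \<in> young_diagram ` L"
        by (auto simp: L_def ferrers_diagrams_def filling_sum_odd_ferrers_graph self_conjugate_iff)
    qed
    show "young_diagram ` L \<subseteq> ferrers_diagrams n"
      by (auto simp: L_def ferrers_diagrams_def filling_sum_odd_ferrers_graph self_conjugate_iff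
          diagram_young_diagram)
  qed
  ultimately show ?thesis using inj by (simp add: card_image)
qed

lemma all_parts_odd_iff:
  assumes "\<forall>k\<in>set \<mu>. 0 < k"
  shows "(\<forall>k\<in>set \<mu>. odd k) \<longleftrightarrow>
    (\<forall>i j. (i, 2 * j) \<in> young_diagram \<mu> \<longrightarrow> (i, Suc (2 * j)) \<in> young_diagram \<mu>)" (is "?l \<longleftrightarrow> ?r")
proof
  assume l: ?l
  show ?r
  proof (intro allI impI)
    fix i j assume ij: "(i, 2 * j) \<in> young_diagram \<mu>"
    then have "i - 1 < length \<mu>" "2 * j \<le> \<mu> ! (i - 1)" by (auto simp: young_diagram_def)
    moreover from this l have "odd (\<mu> ! (i - 1))" by (meson nth_mem)
    ultimately have "Suc (2 * j) \<le> \<mu> ! (i - 1)"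
      by (metis Suc_leI dvd_triv_left le_neq_implies_less)
    with ij show "(i, Suc (2 * j)) \<in> young_diagram \<mu>" by (auto simp: young_diagram_def)
  qed
next
  assume r: ?r
  show ?l
  proof
    fix k assume k: "k \<in> set \<mu>"
    then obtain p where p: "p < length \<mu>" "\<mu> ! p = k" by (auto simp: in_set_conv_nth)
    show "odd k"
    proof
      assume "even k"
      then obtain j where j: "k = 2 * j" by blast
      then have "(Suc p, 2 * j) \<in> young_diagram \<mu>"
        using p k assms by (auto simp: young_diagram_def)
      with r have "(Suc p, Suc (2 * j)) \<in> young_diagram \<mu>" by blast
      with p j show False by (auto simp: young_diagram_def)
    qed
  qed
qed

lemma card_C_eq: "card (C n) = card (odd_row_diagrams n)"
proof -
  have "inj_on young_diagram (C n)"
    by (rule inj_on_subset[OF inj_on_young_diagram]) (auto simp: C_def)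
  moreover have "odd_row_diagrams n = young_diagram ` C n"
  proof
    show "odd_row_diagrams n \<subseteq> young_diagram ` C n"
    proof
      fix D assume D: "D \<in> odd_row_diagrams n"
      then obtain \<mu> where \<mu>: "\<mu> \<in> partitions (card D)" "young_diagram \<mu> = D"
        using young_diagram_surj unfolding odd_row_diagrams_def by blast
      have pos: "\<forall>k\<in>set \<mu>. 0 < k" using \<mu> by (simp add: partitions_def)
      have "\<forall>k\<in>set \<mu>. odd k" "self_conjugate \<mu>"
        using D unfolding all_parts_odd_iff[OF pos] self_conjugate_iff[OF \<mu>(1)] \<mu>(2)
        unfolding odd_row_diagrams_def by blast+
      then have "\<mu> \<in> C n" using D \<mu>(1) by (simp add: C_def odd_row_diagrams_def)
      with \<mu> show "D \<in> young_diagram ` C n" by blast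
    qed
    show "young_diagram ` C n \<subseteq> odd_row_diagrams n"
    proof clarify
      fix \<mu> assume \<mu>: "\<mu> \<in> C n"
      then have p: "\<mu> \<in> partitions (4 * n + 1)" by (simp add: C_def)
      then have pos: "\<forall>k\<in>set \<mu>. 0 < k" and card: "card (young_diagram \<mu>) = 4 * n + 1"
        by (simp_all add: partitions_def card_young_diagram)
      have "\<forall>k\<in>set \<mu>. odd k" "self_conjugate \<mu>" using \<mu> by (simp_all add: C_def)
      then show "young_diagram \<mu> \<in> odd_row_diagrams n"
        unfolding all_parts_odd_iff[OF pos] self_conjugate_iff[OF p]
        unfolding odd_row_diagrams_def using card diagram_young_diagram[OF p] by blast
    qed
  qed
  ultimately show ?thesis by (simp add: card_image)
qed

section \<open>Stretching a diagram by a factor of two\<close>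

text \<open>Row 1 of the stretched diagram comes from row 1, and rows \<open>2 * i\<close> and \<open>2 * i + 1\<close> come from row
  \<open>i + 1\<close>; columns likewise. The preimages under \<open>x \<mapsto> x div 2 + 1\<close> are the fibres below.\<close>

definition stretch :: "(nat \<times> nat) set \<Rightarrow> (nat \<times> nat) set" where
  "stretch D = {(i, j). 0 < i \<and> 0 < j \<and> (Suc (i div 2), Suc (j div 2)) \<in> D}"

definition fibre :: "nat \<Rightarrow> nat set" where
  "fibre i = {x. 0 < x \<and> Suc (x div 2) = i}"

lemma fibre_eq: "0 < i \<Longrightarrow> fibre i = (if i = 1 then {1} else {2 * (i - 1), 2 * i - 1})"
  by (auto simp: fibre_def) (presburger+)?

lemma stretch_fibres: "stretch D = (\<Union>(i, j)\<in>D. fibre i \<times> fibre j)"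
  by (auto simp: stretch_def fibre_def)

text \<open>A cell becomes a block of 1, 2 or 4 cells, which is twice its weight except at the corner, where
  it falls one short.\<close>

lemma card_fibre_product:
  assumes "0 < i" "0 < j"
  shows "card (fibre i \<times> fibre j) + (if (i, j) = (1, 1) then 1 else 0) = 2 * cell_weight (i, j)"
proof -
  have "card (fibre k) = (if k = 1 then 1 else 2)" if "0 < k" for k
    using that by (auto simp: fibre_eq card_insert_if) (presburger+)?
  then show ?thesis using assms by (simp add: card_cartesian_product cell_weight_def)
qed

lemma card_stretch:
  assumes D: "diagram D" and ne: "D \<noteq> {}"
  shows "card (stretch D) + 1 = 2 * sum cell_weight D"
proof -
  have fin: "finite D" using D by (rule diagram_finite)
  have fin': "finite (fibre i)" for i
    by (rule finite_subset[of _ "{..2 * i}"]) (auto simp: fibre_def)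
  have "card (stretch D) = (\<Sum>c\<in>D. card (fibre (fst c) \<times> fibre (snd c)))"
    unfolding stretch_fibres split_beta
    by (rule card_UN_disjoint) (auto simp: fin fin', auto simp: fibre_def)
  moreover have "(1::nat) = (\<Sum>c\<in>D. if c = (1, 1) then 1 else 0)"
    using diagram_nonempty[OF D ne] fin by simp
  ultimately have "card (stretch D) + 1 =
      (\<Sum>c\<in>D. card (fibre (fst c) \<times> fibre (snd c)) + (if c = (1, 1) then 1 else 0))"
    by (simp add: sum.distrib)
  also have "\<dots> = (\<Sum>c\<in>D. 2 * cell_weight c)"
    by (rule sum.cong[OF refl]) (use card_fibre_product diagram_pos[OF D] in force)
  finally show ?thesis by (simp add: sum_distrib_left)
qed

lemma diagram_stretch:
  assumes D: "diagram D"
  shows "diagram (stretch D)"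
proof -
  have "finite (stretch D)"
    by (rule finite_subset[of _ "\<Union>(i, j)\<in>D. {..2 * i} \<times> {..2 * j}"])
      (use diagram_finite[OF D] in \<open>force simp: stretch_def\<close>)+
  moreover have "(i', j') \<in> stretch D"
    if "(i, j) \<in> stretch D" "0 < i'" "i' \<le> i" "0 < j'" "j' \<le> j" for i j i' j'
    using that diagram_down[OF D, of "Suc (i div 2)" "Suc (j div 2)"]
    by (auto simp: stretch_def div_le_mono)
  ultimately show ?thesis unfolding diagram_def by (auto simp: stretch_def)
qed

text \<open>Each block contains exactly one cell with two odd coordinates, so the original diagram can be
  read off from the stretched one.\<close>

lemma stretch_odd: "(Suc (2 * i), Suc (2 * j)) \<in> stretch D \<longleftrightarrow> (Suc i, Suc j) \<in> D"
  by (simp add: stretch_def)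

text \<open>By symmetry the parity condition on rows also holds for columns. Hence membership in \<open>D\<close> does
  not change when an even coordinate is raised by one, and the cells with odd coordinates determine \<open>D\<close>.\<close>

lemma stretch_surj:
  assumes D: "diagram D" and sym: "D\<inverse> = D"
    and odd: "\<And>i j. (i, 2 * j) \<in> D \<Longrightarrow> (i, Suc (2 * j)) \<in> D"
  shows "\<exists>E. diagram E \<and> E\<inverse> = E \<and> stretch E = D"
proof -
  define E where "E = {(i, j). 0 < i \<and> 0 < j \<and> (2 * i - 1, 2 * j - 1) \<in> D}"
  have swap: "(i, j) \<in> D \<longleftrightarrow> (j, i) \<in> D" for i j using sym by (auto simp: set_eq_iff)
  have odd': "(i, j) \<in> D \<longleftrightarrow> (i, Suc (2 * (j div 2))) \<in> D" if "0 < j" for i j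
  proof (cases "even j")
    case True
    then have "2 * (j div 2) = j" by simp
    with odd[of i "j div 2"] diagram_down[OF D, of i "Suc j" i j] diagram_pos[OF D, of i "Suc j"] that
    show ?thesis by auto
  qed simp
  have "(i, j) \<in> D" if "(i, j) \<in> E" for i j
    using that diagram_down[OF D, of "2 * i - 1" "2 * j - 1" i j] by (simp add: E_def)
  then have "finite E" by (metis diagram_finite[OF D] finite_subset subrelI)
  moreover have "(i', j') \<in> E" if "(i, j) \<in> E" "0 < i'" "i' \<le> i" "0 < j'" "j' \<le> j" for i j i' j'
    using that diagram_down[OF D, of "2 * i - 1" "2 * j - 1" "2 * i' - 1" "2 * j' - 1"]
    by (auto simp: E_def)
  ultimately have "diagram E" unfolding diagram_def by (auto simp: E_def)
  moreover have "E\<inverse> = E" using swap by (auto simp: E_def)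
  moreover have "stretch E = D"
  proof (intro set_eqI, clarify)
    fix i j
    have "(i, j) \<in> stretch E \<longleftrightarrow> 0 < i \<and> 0 < j \<and> (Suc (2 * (i div 2)), Suc (2 * (j div 2))) \<in> D"
      by (simp add: stretch_def E_def)
    also have "\<dots> \<longleftrightarrow> 0 < i \<and> 0 < j \<and> (i, j) \<in> D"
      using odd' swap by metis
    also have "\<dots> \<longleftrightarrow> (i, j) \<in> D" using diagram_pos[OF D] by blast
    finally show "(i, j) \<in> stretch E \<longleftrightarrow> (i, j) \<in> D" .
  qed
  ultimately show ?thesis by blast
qed

lemma card_ferrers_diagrams_eq: "card (ferrers_diagrams n) = card (odd_row_diagrams n)"
proof (rule bij_betw_same_card[of stretch])
  show "bij_betw stretch (ferrers_diagrams n) (odd_row_diagrams n)"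
    unfolding bij_betw_def
  proof
    have "D \<subseteq> E" if D: "diagram D" and eq: "stretch D = stretch E" for D E
    proof clarify
      fix i j assume ij: "(i, j) \<in> D"
      then obtain i' j' where "i = Suc i'" "j = Suc j'"
        using diagram_pos[OF D ij] by (metis gr0_implies_Suc)
      then show "(i, j) \<in> E" using ij eq stretch_odd by metis
    qed
    then show "inj_on stretch (ferrers_diagrams n)"
      unfolding inj_on_def ferrers_diagrams_def
      by (metis (no_types, lifting) mem_Collect_eq subset_antisym)
    show "stretch ` ferrers_diagrams n = odd_row_diagrams n"
    proof
      show "stretch ` ferrers_diagrams n \<subseteq> odd_row_diagrams n"
      proof clarify
        fix D assume "D \<in> ferrers_diagrams n"
        then have D: "diagram D" "D\<inverse> = D" "sum cell_weight D = 2 * n + 1"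
          by (auto simp: ferrers_diagrams_def)
        then have "D \<noteq> {}" by auto
        then have "card (stretch D) = 4 * n + 1" using card_stretch[OF D(1)] D(3) by simp
        moreover have "(stretch D)\<inverse> = stretch D" using D(2) by (auto simp: stretch_def)
        moreover have "\<forall>i j. (i, 2 * j) \<in> stretch D \<longrightarrow> (i, Suc (2 * j)) \<in> stretch D"
          by (simp add: stretch_def)
        ultimately show "stretch D \<in> odd_row_diagrams n"
          using diagram_stretch[OF D(1)] by (simp add: odd_row_diagrams_def)
      qed
      show "odd_row_diagrams n \<subseteq> stretch ` ferrers_diagrams n"
      proof
        fix D assume D: "D \<in> odd_row_diagrams n"
        then obtain E where E: "diagram E" "E\<inverse> = E" "stretch E = D"
          using stretch_surj[of D] by (auto simp: odd_row_diagrams_def)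
        then have "E \<noteq> {}" using D by (auto simp: odd_row_diagrams_def stretch_def)
        with E D have "sum cell_weight E = 2 * n + 1"
          using card_stretch[OF E(1)] by (simp add: odd_row_diagrams_def)
        with E show "D \<in> stretch ` ferrers_diagrams n"
          by (auto simp: ferrers_diagrams_def)
      qed
    qed
  qed
qed

section \<open>The Durfee square of a symmetric diagram\<close>

text \<open>Here \<open>d\<close> stands for the side of a Durfee square and \<open>c\<close> for the rows below it. The last
  equation is the weight condition after removing the summand 1 and halving.\<close>

definition durfee_pairs :: "nat \<Rightarrow> (nat \<times> nat list) set" where
  "durfee_pairs n = {(d, c). 0 < d \<and> sorted_wrt (\<ge>) c \<and> set c \<subseteq> {1..d} \<and>
     d * (d - 1) + (\<Sum>x\<leftarrow>c. 2 * x - 1) = n}"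

text \<open>The symmetric diagram with Durfee square of side \<open>d\<close> and with \<open>E\<close> below the square.\<close>

definition assemble :: "nat \<Rightarrow> (nat \<times> nat) set \<Rightarrow> (nat \<times> nat) set" where
  "assemble d E = {1..d} \<times> {1..d} \<union> (\<lambda>(i, j). (i + d, j)) ` E \<union> (\<lambda>(i, j). (j, i + d)) ` E"

lemma cell_weight_square: "0 < d \<Longrightarrow> sum cell_weight ({1..d} \<times> {1..d}) = 2 * (d * (d - 1)) + 1"
proof -
  assume "0 < d"
  then obtain k where d: "d = Suc k" by (metis gr0_implies_Suc)
  have split: "{1..d} = insert 1 {2..d}" using d by auto
  have "sum cell_weight ({1..d} \<times> {1..d}) = (\<Sum>i\<in>{1..d}. \<Sum>j\<in>{1..d}. cell_weight (i, j))"
    by (simp add: sum.cartesian_product)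
  also have "\<dots> = (\<Sum>j\<in>{1..d}. 1) + (\<Sum>i\<in>{2..d}. 1 + (\<Sum>j\<in>{2..d}. 2))"
    unfolding split by (simp add: cell_weight_def)
  also have "\<dots> = 2 * (d * (d - 1)) + 1"
    by (simp add: d algebra_simps)
  finally show ?thesis .
qed

text \<open>Below the Durfee square only the first column carries weight 1, so a row of length \<open>x\<close> weighs
  \<open>1 + 2 * (x - 1)\<close>.\<close>

lemma sum_over_rows:
  assumes "\<forall>k\<in>set c. 0 < k"
  shows "(\<Sum>p\<in>young_diagram c. if snd p = 1 then 1 else 2) = (\<Sum>x\<leftarrow>c. 2 * x - 1 :: nat)"
proof -
  have row: "(\<Sum>j\<in>{1..k}. if j = 1 then 1 else 2) = 2 * k - 1" for k :: nat
    by (induction k) auto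
  have "(\<Sum>p\<in>young_diagram c. if snd p = 1 then 1 else 2) =
      (\<Sum>i\<in>{1..length c}. \<Sum>j\<in>{1..c ! (i - 1)}. if j = 1 then 1 else 2 :: nat)"
    unfolding young_diagram_row by (subst sum.Sigma) (auto intro: sum.cong)
  also have "\<dots> = (\<Sum>i\<in>{1..length c}. 2 * c ! (i - 1) - 1)" by (simp only: row)
  also have "\<dots> = (\<Sum>i<length c. 2 * c ! i - 1)"
    by (rule sum.reindex_bij_witness[of _ Suc "\<lambda>i. i - 1"]) auto
  finally show ?thesis by (simp add: sum_list_sum_nth lessThan_atLeast0)
qed

text \<open>The part below the square and its mirror image on the right contribute equally, hence the
  factor 2 in front of the sum over \<open>E\<close>.\<close>

lemma cell_weight_assemble:
  assumes "0 < d" and E: "diagram E" "E \<subseteq> UNIV \<times> {1..d}"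
  shows "sum cell_weight (assemble d E) =
    2 * (d * (d - 1) + (\<Sum>p\<in>E. if snd p = 1 then 1 else 2)) + 1"
proof -
  define L where "L = (\<lambda>(i, j). (i + d, j)) ` E"
  define R where "R = (\<lambda>(i, j). (j, i + d)) ` E"
  have fin: "finite E" using E(1) by (rule diagram_finite)
  have pos: "(i, j) \<in> E \<Longrightarrow> 0 < i \<and> 0 < j \<and> j \<le> d" for i j
    using diagram_pos[OF E(1)] E(2) by auto
  have "assemble d E = {1..d} \<times> {1..d} \<union> L \<union> R"
    by (simp only: assemble_def L_def R_def)
  moreover have "({1..d} \<times> {1..d}) \<inter> L = {}" "({1..d} \<times> {1..d} \<union> L) \<inter> R = {}"
    unfolding L_def R_def by (auto dest!: pos)
  moreover have "finite L" "finite R" using fin by (simp_all add: L_def R_def)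
  ultimately have "sum cell_weight (assemble d E) =
      sum cell_weight ({1..d} \<times> {1..d}) + sum cell_weight L + sum cell_weight R"
    by (simp add: sum.union_disjoint)
  moreover have "sum cell_weight L = (\<Sum>p\<in>E. if snd p = 1 then 1 else 2)"
    unfolding L_def using assms(1)
    by (subst sum.reindex) (auto simp: inj_on_def cell_weight_def intro!: sum.cong dest!: pos)
  moreover have "sum cell_weight R = (\<Sum>p\<in>E. if snd p = 1 then 1 else 2)"
    unfolding R_def using assms(1)
    by (subst sum.reindex) (auto simp: inj_on_def cell_weight_def intro!: sum.cong dest!: pos)
  ultimately show ?thesis using cell_weight_square[OF assms(1)] by simp
qed

lemma converse_assemble: "(assemble d E)\<inverse> = assemble d E"
  unfolding assemble_def by force

lemma mem_assemble:
  assumes "diagram E" "E \<subseteq> UNIV \<times> {1..d}"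
  shows "(i, j) \<in> assemble d E \<longleftrightarrow> 0 < i \<and> 0 < j \<and>
    (i \<le> d \<and> j \<le> d \<or> d < i \<and> (i - d, j) \<in> E \<or> d < j \<and> (j - d, i) \<in> E)"
proof -
  have pos: "(i, j) \<in> E \<Longrightarrow> 0 < i \<and> 0 < j \<and> j \<le> d" for i j
    using diagram_pos[OF assms(1)] assms(2) by auto
  have "(i, j) \<in> (\<lambda>(i, j). (i + d, j)) ` E \<longleftrightarrow> d < i \<and> (i - d, j) \<in> E" for i j
    by (auto simp: image_iff dest: pos intro!: bexI[of _ "(i - d, j)"])
  moreover have "(i, j) \<in> (\<lambda>(i, j). (j, i + d)) ` E \<longleftrightarrow> d < j \<and> (j - d, i) \<in> E" for i j
    by (auto simp: image_iff dest: pos intro!: bexI[of _ "(j - d, i)"])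
  ultimately show ?thesis
    unfolding assemble_def using pos[of "i - d" j] pos[of "j - d" i] by auto
qed

lemma diagram_assemble:
  assumes E: "diagram E" "E \<subseteq> UNIV \<times> {1..d}"
  shows "diagram (assemble d E)"
proof -
  have "finite (assemble d E)" using diagram_finite[OF E(1)] by (simp add: assemble_def)
  moreover have "(i', j') \<in> assemble d E"
    if "(i, j) \<in> assemble d E" "0 < i'" "i' \<le> i" "0 < j'" "j' \<le> j" for i j i' j'
  proof -
    have le: "(x, y) \<in> E \<Longrightarrow> y \<le> d" for x y using E(2) by auto
    show ?thesis
      using that le[of "i - d" j] le[of "j - d" i]
        diagram_down[OF E(1), of "i - d" j "i' - d" j'] diagram_down[OF E(1), of "j - d" i "j' - d" i']
      unfolding mem_assemble[OF E] by (smt (verit) diff_le_mono le_trans not_le zero_less_diff)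
  qed
  ultimately show ?thesis unfolding diagram_def using mem_assemble[OF E] by blast
qed

lemma assemble_diagonal:
  assumes "diagram E" "E \<subseteq> UNIV \<times> {1..d}"
  shows "{i. (i, i) \<in> assemble d E} = {1..d}"
  using assms(2) by (auto simp: mem_assemble[OF assms])

lemma assemble_below:
  assumes "diagram E" "E \<subseteq> UNIV \<times> {1..d}"
  shows "E = {(i, j). 0 < i \<and> (i + d, j) \<in> assemble d E}"
  using assms(2) diagram_pos[OF assms(1)] by (auto simp: mem_assemble[OF assms])

text \<open>The diagonal cells of \<open>D\<close> form an initial segment, whose length \<open>d\<close> is the side of the Durfee
  square. Since \<open>(d + 1, d + 1)\<close> is not a cell, every other cell lies strictly below or strictly to
  the right of the square, within its width or height, and symmetry relates the two regions.\<close>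

lemma assemble_surj:
  assumes D: "diagram D" and sym: "D\<inverse> = D" and ne: "D \<noteq> {}"
  shows "\<exists>d E. 0 < d \<and> diagram E \<and> E \<subseteq> UNIV \<times> {1..d} \<and> assemble d E = D"
proof -
  define d where "d = card {i. (i, i) \<in> D}"
  define E where "E = {(i, j). 0 < i \<and> (i + d, j) \<in> D}"
  have swap: "(i, j) \<in> D \<longleftrightarrow> (j, i) \<in> D" for i j using sym by (auto simp: set_eq_iff)
  note down = diagram_down[OF D] and pos = diagram_pos[OF D]
  have "finite {i. (i, i) \<in> D}"
    by (rule finite_subset[of _ "fst ` D"]) (use diagram_finite[OF D] in force)+
  then have diag: "{i. (i, i) \<in> D} = {1..d}"
    unfolding d_def by (rule down_set_eq_atLeastAtMost) (use pos down in blast)+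
  then have diag': "(i, i) \<in> D \<longleftrightarrow> 0 < i \<and> i \<le> d" for i by (auto simp: set_eq_iff Suc_le_eq)
  have "0 < d" using diagram_nonempty[OF D ne] diag'[of 1] by simp
  moreover have dE: "diagram E"
  proof -
    have "(i, j) \<in> D" if "(i, j) \<in> E" for i j
      using that down[of "i + d" j i j] pos[of "i + d" j] by (simp add: E_def)
    then have "finite E" by (metis diagram_finite[OF D] finite_subset subrelI)
    moreover have "(i', j') \<in> E" if "(i, j) \<in> E" "0 < i'" "i' \<le> i" "0 < j'" "j' \<le> j" for i j i' j'
      using that down[of "i + d" j "i' + d" j'] by (auto simp: E_def)
    ultimately show ?thesis unfolding diagram_def using pos by (auto simp: E_def)
  qed
  moreover have EE: "E \<subseteq> UNIV \<times> {1..d}"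
  proof (rule subrelI)
    fix i j assume "(i, j) \<in> E"
    then have ij: "0 < i" "(i + d, j) \<in> D" by (auto simp: E_def)
    have "j \<le> d"
    proof (rule ccontr)
      assume "\<not> j \<le> d"
      then have "(Suc d, Suc d) \<in> D" using ij by (intro down[OF ij(2)]) auto
      with diag' show False by simp
    qed
    with pos[OF ij(2)] \<open>j \<le> d\<close> show "(i, j) \<in> UNIV \<times> {1..d}" by simp
  qed
  moreover have "assemble d E = D"
  proof (intro set_eqI, clarify)
    fix i j
    have "(i, j) \<in> D" if "0 < i" "i \<le> d" "0 < j" "j \<le> d"
      using down[of d d i j] diag'[of d] that by simp
    moreover have "\<not> (d < i \<and> d < j)" if "(i, j) \<in> D"
      using down[OF that, of "Suc d" "Suc d"] diag'[of "Suc d"] by auto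
    ultimately show "(i, j) \<in> assemble d E \<longleftrightarrow> (i, j) \<in> D"
      unfolding mem_assemble[OF dE EE] using pos[of i j] swap[of i j] by (auto simp: E_def)
  qed
  ultimately show ?thesis by blast
qed

lemma young_diagram_subset_iff:
  assumes "\<forall>k\<in>set c. 0 < k"
  shows "young_diagram c \<subseteq> UNIV \<times> {1..d} \<longleftrightarrow> set c \<subseteq> {1..d}"
proof
  assume sub: "young_diagram c \<subseteq> UNIV \<times> {1..d}"
  show "set c \<subseteq> {1..d}"
  proof
    fix k assume k: "k \<in> set c"
    then obtain p where "p < length c" "c ! p = k" by (auto simp: in_set_conv_nth)
    with k assms have "(Suc p, k) \<in> young_diagram c" by (auto simp: young_diagram_def Suc_le_eq)
    with sub show "k \<in> {1..d}" by auto
  qed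
next
  assume "set c \<subseteq> {1..d}"
  moreover have "c ! (i - 1) \<in> set c" if "1 \<le> i" "i \<le> length c" for i using that by simp
  ultimately show "young_diagram c \<subseteq> UNIV \<times> {1..d}"
    unfolding young_diagram_def by fastforce
qed

lemma durfee_pairs_iff:
  "(d, c) \<in> durfee_pairs n \<longleftrightarrow> 0 < d \<and> c \<in> partitions (sum_list c) \<and>
     young_diagram c \<subseteq> UNIV \<times> {1..d} \<and> sum cell_weight (assemble d (young_diagram c)) = 2 * n + 1"
    (is "?l \<longleftrightarrow> ?r")
proof (cases "0 < d \<and> sorted_wrt (\<ge>) c \<and> set c \<subseteq> {1..d}")
  case True
  then have pos: "\<forall>k\<in>set c. 0 < k" by auto
  with True have c: "c \<in> partitions (sum_list c)" by (simp add: partitions_def)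
  have sub: "young_diagram c \<subseteq> UNIV \<times> {1..d}"
    using young_diagram_subset_iff[OF pos] True by blast
  have "sum cell_weight (assemble d (young_diagram c)) = 2 * (d * (d - 1) + (\<Sum>x\<leftarrow>c. 2 * x - 1)) + 1"
    using cell_weight_assemble[OF _ diagram_young_diagram[OF c] sub] True
    by (simp only: sum_over_rows[OF pos])
  with True c sub show ?thesis by (auto simp: durfee_pairs_def)
next
  case False
  then have "\<not> ?l" by (auto simp: durfee_pairs_def)
  moreover have "\<not> ?r"
    using False young_diagram_subset_iff[of c d] unfolding partitions_def by blast
  ultimately show ?thesis by blast
qed

lemma card_durfee_pairs: "card (durfee_pairs n) = card (ferrers_diagrams n)"
proof (rule bij_betw_same_card[of "\<lambda>(d, c). assemble d (young_diagram c)"])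
  show "bij_betw (\<lambda>(d, c). assemble d (young_diagram c)) (durfee_pairs n) (ferrers_diagrams n)"
    unfolding bij_betw_def
  proof
    show "inj_on (\<lambda>(d, c). assemble d (young_diagram c)) (durfee_pairs n)"
    proof (rule inj_onI, clarify)
      fix d c d' c'
      assume m: "(d, c) \<in> durfee_pairs n" "(d', c') \<in> durfee_pairs n"
        and eq: "assemble d (young_diagram c) = assemble d' (young_diagram c')"
      from m have c: "diagram (young_diagram c)" "young_diagram c \<subseteq> UNIV \<times> {1..d}"
          "\<forall>k\<in>set c. 0 < k"
        and c': "diagram (young_diagram c')" "young_diagram c' \<subseteq> UNIV \<times> {1..d'}"
          "\<forall>k\<in>set c'. 0 < k"
        using diagram_young_diagram unfolding durfee_pairs_iff by (auto simp: partitions_def)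
      have "{1..d} = {1..d'}"
        using assemble_diagonal[OF c(1,2)] assemble_diagonal[OF c'(1,2)] eq by metis
      from arg_cong[OF this, of card] have d: "d = d'" by simp
      then have "young_diagram c = young_diagram c'"
        using assemble_below[OF c(1,2)] assemble_below[OF c'(1,2)] eq by simp
      with d show "d = d' \<and> c = c'" using young_diagram_inject c(3) c'(3) by blast
    qed
    show "(\<lambda>(d, c). assemble d (young_diagram c)) ` durfee_pairs n = ferrers_diagrams n"
    proof
      show "(\<lambda>(d, c). assemble d (young_diagram c)) ` durfee_pairs n \<subseteq> ferrers_diagrams n"
      proof clarify
        fix d c assume m: "(d, c) \<in> durfee_pairs n"
        then have "diagram (young_diagram c)" "young_diagram c \<subseteq> UNIV \<times> {1..d}"
          using diagram_young_diagram unfolding durfee_pairs_iff by blast+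
        with m show "assemble d (young_diagram c) \<in> ferrers_diagrams n"
          by (simp add: durfee_pairs_iff ferrers_diagrams_def converse_assemble diagram_assemble)
      qed
      show "ferrers_diagrams n \<subseteq> (\<lambda>(d, c). assemble d (young_diagram c)) ` durfee_pairs n"
      proof
        fix D assume "D \<in> ferrers_diagrams n"
        then have D: "diagram D" "D\<inverse> = D" "sum cell_weight D = 2 * n + 1"
          by (auto simp: ferrers_diagrams_def)
        then have "D \<noteq> {}" by auto
        then obtain d E where E: "0 < d" "diagram E" "E \<subseteq> UNIV \<times> {1..d}" "assemble d E = D"
          using assemble_surj[OF D(1,2)] by blast
        then obtain c where "c \<in> partitions (card E)" "young_diagram c = E"
          using young_diagram_surj by blast
        with E D have "(d, c) \<in> durfee_pairs n"
          unfolding durfee_pairs_iff by (auto simp: partitions_def)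
        moreover have "D = (\<lambda>(d, c). assemble d (young_diagram c)) (d, c)"
          using E \<open>young_diagram c = E\<close> by simp
        ultimately show "D \<in> (\<lambda>(d, c). assemble d (young_diagram c)) ` durfee_pairs n"
          by (rule rev_image_eqI)
      qed
    qed
  qed
qed

section \<open>Interleaving even and odd parts\<close>

text \<open>If \<open>2 * x\<close> is a part, all smaller positive even numbers lie below the largest part and are
  therefore parts; so the halves of the even parts form a down-set.\<close>

lemma A_even_parts:
  assumes "\<mu> \<in> A n"
  shows "set (filter even \<mu>) = (*) 2 ` {1..length (filter even \<mu>)}"
proof -
  define S where "S = {m. 2 * m \<in> set \<mu>}"
  have \<mu>: "sorted_wrt (\<ge>) \<mu>" "\<forall>k\<in>set \<mu>. 0 < k" "distinct (filter even \<mu>)"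
    "\<And>m. m > 0 \<Longrightarrow> \<mu> \<noteq> [] \<Longrightarrow> 2 * m < hd \<mu> \<Longrightarrow> 2 * m \<in> set \<mu>"
    using assms by (auto simp: A_def partitions_def)
  have img: "set (filter even \<mu>) = (*) 2 ` S" by (auto simp: S_def elim!: evenE)
  have "finite S" unfolding S_def by (rule finite_subset[of _ "(\<lambda>x. x div 2) ` set \<mu>"]) force+
  then have "S = {1..card S}"
  proof (rule down_set_eq_atLeastAtMost)
    show "0 \<notin> S" using \<mu>(2) by (auto simp: S_def)
    fix x y assume xy: "x \<in> S" "0 < y" "y \<le> x"
    then have "2 * x \<in> set \<mu>" by (simp add: S_def)
    moreover have "k \<le> hd \<mu>" if "k \<in> set \<mu>" for k using that \<mu>(1) by (cases \<mu>) auto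
    ultimately have "2 * x \<le> hd \<mu>" "\<mu> \<noteq> []" by auto
    then show "y \<in> S" using xy \<mu>(4)[of y] by (cases "y = x") (auto simp: S_def)
  qed
  moreover have "length (filter even \<mu>) = card S"
    using distinct_card[OF \<mu>(3)] img by (simp add: card_image inj_on_def)
  ultimately show ?thesis using img by simp
qed

text \<open>A larger odd part would force one more even part than there are.\<close>

lemma A_odd_parts_le:
  assumes "\<mu> \<in> A n" "x \<in> set \<mu>" "odd x"
  shows "x \<le> 2 * length (filter even \<mu>) + 1"
proof (rule ccontr)
  let ?k = "length (filter even \<mu>)"
  assume "\<not> ?thesis"
  then have "2 * Suc ?k < x" using \<open>odd x\<close> by (auto elim!: oddE)
  moreover have "x \<le> hd \<mu>" using assms by (cases \<mu>) (auto simp: A_def partitions_def)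
  ultimately have "2 * Suc ?k < hd \<mu>" by simp
  moreover have "\<mu> \<noteq> []" using assms(2) by auto
  moreover have "\<forall>m>0. \<mu> \<noteq> [] \<and> 2 * m < hd \<mu> \<longrightarrow> 2 * m \<in> set \<mu>"
    using assms(1) unfolding A_def by blast
  ultimately have "2 * Suc ?k \<in> set \<mu>" by blast
  then have "2 * Suc ?k \<in> (*) 2 ` {1..?k}"
    unfolding A_even_parts[OF assms(1), symmetric] by simp
  then show False by auto
qed

definition merge_parts :: "nat \<times> nat list \<Rightarrow> nat list" where
  "merge_parts = (\<lambda>(d, c). rev (sort (map ((*) 2) [1..<d] @ map (\<lambda>x. 2 * x - 1) c)))"

lemma sum_even_parts: "(\<Sum>x\<leftarrow>[1..<d]. 2 * x) = d * (d - 1)"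
  by (induction d) (auto simp: algebra_simps)

lemma sorted_desc_eqI:
  fixes xs ys :: "nat list"
  assumes "sorted_wrt (\<ge>) xs" "sorted_wrt (\<ge>) ys" "mset xs = mset ys"
  shows "xs = ys"
proof -
  have "sorted (rev xs)" "sorted (rev ys)" using assms by (simp_all add: sorted_wrt_rev)
  with assms(3) show ?thesis by (metis mset_rev properties_for_sort rev_rev_ident)
qed

text \<open>The even and the odd parts of the merged partition give back \<open>d\<close> and \<open>c\<close>, which yields
  injectivity. Every odd part is at most \<open>2 * d - 1\<close>, so no even number missing from the list lies
  below the largest part.\<close>

lemma merge_parts_props:
  assumes "(d, c) \<in> durfee_pairs n"
  shows "filter even (merge_parts (d, c)) = rev (map ((*) 2) [1..<d])"
    and "filter odd (merge_parts (d, c)) = map (\<lambda>x. 2 * x - 1) c"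
    and "merge_parts (d, c) \<in> A n"
proof -
  let ?m = "merge_parts (d, c)"
  have c: "0 < d" "sorted_wrt (\<ge>) c" "set c \<subseteq> {1..d}" "d * (d - 1) + (\<Sum>x\<leftarrow>c. 2 * x - 1) = n"
    using assms by (auto simp: durfee_pairs_def)
  have odd: "odd (2 * x - 1)" if "x \<in> set c" for x using that c(3) by auto
  have desc: "sorted_wrt (\<ge>) ?m" by (simp add: merge_parts_def sorted_wrt_rev)
  have ms: "mset ?m = mset (map ((*) 2) [1..<d] @ map (\<lambda>x. 2 * x - 1) c)"
    by (simp add: merge_parts_def)
  have st: "set ?m = (*) 2 ` {1..<d} \<union> (\<lambda>x. 2 * x - 1) ` set c"
    by (simp add: merge_parts_def)
  have fe: "filter even (map (\<lambda>x. 2 * x - 1) c) = []"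
    "filter odd (map (\<lambda>x. 2 * x - 1) c) = map (\<lambda>x. 2 * x - 1) c"
    using odd by (auto simp: filter_empty_conv filter_id_conv)
  have fe': "filter even (map ((*) 2) [1..<d]) = map ((*) 2) [1..<d]"
    "filter odd (map ((*) (2::nat)) [1..<d]) = []"
    by (auto simp: filter_empty_conv filter_id_conv)
  show ev: "filter even ?m = rev (map ((*) 2) [1..<d])"
  proof (rule sorted_desc_eqI)
    show "sorted_wrt (\<ge>) (filter even ?m)" using desc by (rule sorted_wrt_filter)
    have "sorted (map ((*) 2) [1..<d])"
      by (auto simp: sorted_iff_nth_mono)
    then show "sorted_wrt (\<ge>) (rev (map ((*) 2) [1..<d]))" by (simp add: sorted_wrt_rev)
    show "mset (filter even ?m) = mset (rev (map ((*) 2) [1..<d]))"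
      unfolding mset_filter ms unfolding mset_filter[symmetric] filter_append fe fe' by simp
  qed
  show "filter odd ?m = map (\<lambda>x. 2 * x - 1) c"
  proof (rule sorted_desc_eqI)
    show "sorted_wrt (\<ge>) (filter odd ?m)" using desc by (rule sorted_wrt_filter)
    show "sorted_wrt (\<ge>) (map (\<lambda>x. 2 * x - 1) c)"
      unfolding sorted_wrt_map using c(2) by (rule sorted_wrt_mono_rel[rotated]) auto
    show "mset (filter odd ?m) = mset (map (\<lambda>x. 2 * x - 1) c)"
      unfolding mset_filter ms unfolding mset_filter[symmetric] filter_append fe fe' by simp
  qed
  note sum_even_parts[of d]
  moreover have "sum_list ?m = sum_list (map ((*) 2) [1..<d] @ map (\<lambda>x. 2 * x - 1) c)"
    using ms by (metis sum_mset_sum_list)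
  ultimately have sum: "sum_list ?m = n" using c(4) by simp
  have "\<forall>k\<in>set ?m. 0 < k" unfolding st using c(3) by auto
  moreover have "2 * m \<in> set ?m" if "0 < m" "?m \<noteq> []" "2 * m < hd ?m" for m
  proof -
    have "hd ?m \<le> 2 * d - 1"
      using hd_in_set[OF that(2)] c(3) unfolding st by (fastforce intro: diff_le_mono)
    with that show ?thesis unfolding st by auto
  qed
  moreover have "distinct (filter even ?m)" unfolding ev by (simp add: distinct_map inj_on_def)
  ultimately show "?m \<in> A n" using desc sum by (auto simp: A_def partitions_def)
qed

lemma card_A_eq: "card (A n) = card (durfee_pairs n)"
proof (rule sym, rule bij_betw_same_card[of merge_parts])
  show "bij_betw merge_parts (durfee_pairs n) (A n)"
    unfolding bij_betw_def
  proof
    show "inj_on merge_parts (durfee_pairs n)"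
    proof (rule inj_onI, clarify)
      fix d c d' c'
      assume m: "(d, c) \<in> durfee_pairs n" "(d', c') \<in> durfee_pairs n"
        and eq: "merge_parts (d, c) = merge_parts (d', c')"
      have "rev (map ((*) 2) [1..<d]) = rev (map ((*) (2::nat)) [1..<d'])"
        using merge_parts_props(1)[OF m(1)] merge_parts_props(1)[OF m(2)] eq by simp
      from arg_cong[OF this, of length] have "d = d'"
        using m by (auto simp: durfee_pairs_def)
      moreover have "map (\<lambda>x. 2 * x - 1) c = map (\<lambda>x. 2 * x - 1) c'"
        using merge_parts_props(2)[OF m(1)] merge_parts_props(2)[OF m(2)] eq by simp
      then have "c = c'"
        by (rule map_inj_on) (use m in \<open>auto simp: durfee_pairs_def inj_on_def\<close>)
      ultimately show "d = d' \<and> c = c'" by blast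
    qed
    show "merge_parts ` durfee_pairs n = A n"
    proof
      show "merge_parts ` durfee_pairs n \<subseteq> A n" using merge_parts_props(3) by auto
      show "A n \<subseteq> merge_parts ` durfee_pairs n"
      proof
        fix \<mu> assume \<mu>: "\<mu> \<in> A n"
        \<comment> \<open>With \<open>k\<close> even parts, the largest is \<open>2 * k\<close> and odd parts go up to \<open>2 * k + 1\<close>, hence \<open>d = k + 1\<close>.\<close>
        define d where "d = Suc (length (filter even \<mu>))"
        define c where "c = map (\<lambda>x. Suc x div 2) (filter odd \<mu>)"
        have desc: "sorted_wrt (\<ge>) \<mu>" and sum: "sum_list \<mu> = n" and dist: "distinct (filter even \<mu>)"
          using \<mu> by (auto simp: A_def partitions_def)
        have odds: "map (\<lambda>x. 2 * x - 1) c = filter odd \<mu>"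
          unfolding c_def map_map by (rule map_idI) (auto elim!: oddE)
        have evs: "mset (filter even \<mu>) = mset (map ((*) 2) [1..<d])"
        proof -
          have "set (filter even \<mu>) = set (map ((*) 2) [1..<d])"
            using A_even_parts[OF \<mu>] by (simp add: d_def atLeastLessThanSuc_atLeastAtMost del: upt_Suc)
          moreover have "distinct (map ((*) (2::nat)) [1..<d])" by (simp add: distinct_map inj_on_def)
          ultimately show ?thesis using dist set_eq_iff_mset_eq_distinct by blast
        qed
        have mset_split: "mset \<mu> = mset (map ((*) 2) [1..<d] @ map (\<lambda>x. 2 * x - 1) c)"
          using evs odds by (metis mset_append mset_filter multiset_partition)
        have "merge_parts (d, c) = \<mu>"
          by (rule sorted_desc_eqI) (use desc mset_split in \<open>simp_all add: merge_parts_def sorted_wrt_rev\<close>)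
        moreover have "(d, c) \<in> durfee_pairs n"
        proof -
          have "sorted_wrt (\<ge>) c"
            unfolding c_def sorted_wrt_map
            using sorted_wrt_filter[OF desc] by (rule sorted_wrt_mono_rel[rotated]) (auto intro: div_le_mono)
          moreover have "set c \<subseteq> {1..d}"
            using A_odd_parts_le[OF \<mu>] by (fastforce simp: c_def d_def elim!: oddE)
          moreover have "d * (d - 1) + (\<Sum>x\<leftarrow>c. 2 * x - 1) = n"
            using sum mset_split sum_even_parts[of d] by (metis map_append sum_list_append sum_mset_sum_list)
          ultimately show ?thesis by (simp add: durfee_pairs_def d_def)
        qed
        ultimately show "\<mu> \<in> merge_parts ` durfee_pairs n" by (metis rev_image_eqI)
      qed
    qed
  qed
qed

theorem theorem5p2:
  fixes n :: nat
  shows "card (A n) = card (B n) \<and> card (B n) = card (C n)"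
  using card_A_eq card_durfee_pairs card_B_eq card_ferrers_diagrams_eq card_C_eq by simp

end
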